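(* Let $m,n\ge 2$ be integers. There exists a ${}^2\mathrm{H}(m,n;n,m)$ (an $m\times n$ $2$-fold Heffter array with no empty cells) if and only if $mn\not\equiv 1\pmod 4$ and $m,n$ are not both equal to $2$.
   Context: For positive integers $m,n,s,k,\lambda,t$ with $t$ dividing $\frac{2nk}{\lambda}$, let $v=\frac{2nk}{\lambda}+t$ and $J$ the subgroup of $\mathbb{Z}_v$ of order $t$. A ${}^\lambda\mathrm{H}_t(m,n;s,k)$ is an $m\times n$ partially filled array with entries in $\mathbb{Z}_v$ such that: (a) each row has exactly $s$ and each column exactly $k$ filled cells; (b) the multiset $\{\pm x: x$ an entry of a filled cell$\}$ contains each element of $\mathbb{Z}_v\setminus J$ exactly $\lambda$ times and no element of $J$; (c) every row and every column sums to $0$ in $\mathbb{Z}_v$. The subscript $t$ is omitted when $t=1$; thus ${}^2\mathrm{H}(m,n;n,m)$ is an $m\times n$ array over $\mathbb{Z}_{mn+1}$ with all cells filled. *)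

theory Defs
  imports Main "HOL-Library.Multiset"
begin

text \<open>A partially filled m x n array over Z_v: cells (i,j) with i<m, j<n;
  None = empty cell, Some x = filled with the residue represented by x in {0..<v}.\<close>

type_synonym parray = "nat \<Rightarrow> nat \<Rightarrow> int option"

definition filled_cells :: "nat \<Rightarrow> nat \<Rightarrow> parray \<Rightarrow> (nat \<times> nat) set" where
  "filled_cells m n A = {(i,j). i < m \<and> j < n \<and> A i j \<noteq> None}"

definition subgrpJ :: "int \<Rightarrow> int \<Rightarrow> int set" where
  "subgrpJ v t = {x. 0 \<le> x \<and> x < v \<and> (v div t) dvd x}"

definition heffter :: "nat \<Rightarrow> nat \<Rightarrow> nat \<Rightarrow> nat \<Rightarrow> nat \<Rightarrow> nat \<Rightarrow> parray \<Rightarrow> bool" where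
  "heffter lam t m n s k A \<longleftrightarrow>
     (let v = int (2*n*k div lam + t) in
       0 < m \<and> 0 < n \<and> 0 < s \<and> 0 < k \<and> 0 < lam \<and> 0 < t \<and>
       lam dvd 2*n*k \<and> t dvd (2*n*k div lam) \<and>
       (\<forall>i j. (i \<ge> m \<or> j \<ge> n) \<longrightarrow> A i j = None) \<and>
       (\<forall>i j x. A i j = Some x \<longrightarrow> 0 \<le> x \<and> x < v) \<and>
       (\<forall>i<m. card {j. j < n \<and> A i j \<noteq> None} = s) \<and>
       (\<forall>j<n. card {i. i < m \<and> A i j \<noteq> None} = k) \<and>
       (\<Sum>\<^sub># (image_mset (\<lambda>c. {# the (A (fst c) (snd c)), (- the (A (fst c) (snd c))) mod v #})
              (mset_set (filled_cells m n A))))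
         = (\<Sum>x\<in>{0..<v} - subgrpJ v (int t). replicate_mset lam x) \<and>
       (\<forall>i<m. (\<Sum>j\<in>{j. j < n \<and> A i j \<noteq> None}. the (A i j)) mod v = 0) \<and>
       (\<forall>j<n. (\<Sum>i\<in>{i. i < m \<and> A i j \<noteq> None}. the (A i j)) mod v = 0))"

end

theory Submission
  imports Defs
begin

text \<open>
  Since signs may be chosen freely, what matters is the multiset of absolute values: an array over
  \<open>Z\<^sub>v\<close>, \<open>v = mn + 1\<close>, has to use every value in \<open>1, \<dots>, \<lfloor>mn/2\<rfloor>\<close> twice and, for odd \<open>mn\<close>, also
  \<open>v/2\<close> once. Zero-sum arrays can be glued along their sides, so it suffices to cut the values
  suitably. Two families of blocks do most of the work: \<open>2 \<times> 4\<close> tiles on two pairs of consecutive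
  values, and \<open>3 \<times> 2\<close> blocks whose columns are \<open>(a, b, -a-b)\<close> and its negative.

  The values of the \<open>3 \<times> 2\<close> blocks form two nested families: \<open>2i, w - i, w + i\<close> uses the
  even differences in a block centred at \<open>w\<close>, and \<open>2i - 1, b - i, b + i - 1\<close> uses the odd
  differences. The few values left over, such as the centre \<open>w\<close>, are absorbed by a small core array.
  If \<open>mn mod 4 = 3\<close> then \<open>v = 4w\<close>, and centring the first family at \<open>w\<close> makes \<open>(v/2, w, w)\<close> a
  zero-sum row of the core.

  Conversely, if \<open>mn mod 4 = 1\<close> then \<open>v\<close> is even, so the sum of all entries is even, although the
  number of odd entries is \<open>v/2\<close>, which is odd; and in a \<open>2 \<times> 2\<close> array all entries agree up to sign.
\<close>

section \<open>Zero-sum arrays\<close>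

text \<open>Taking absolute values on both sides leaves the signs of the entries free and spares
  side conditions such as nonnegativity of \<open>M\<close>, so blocks can be stated for arbitrary
  integers.\<close>

definition zero_sum_array :: "int \<Rightarrow> nat \<Rightarrow> nat \<Rightarrow> int multiset \<Rightarrow> bool" where
  "zero_sum_array v m n M \<longleftrightarrow>
     (\<exists>f. (\<Sum>i<m. \<Sum>j<n. {#\<bar>f i j\<bar>#}) = image_mset abs M \<and>
          (\<forall>i<m. v dvd (\<Sum>j<n. f i j)) \<and> (\<forall>j<n. v dvd (\<Sum>i<m. f i j)))"

lemma zero_sum_array_transpose:
  assumes "zero_sum_array v m n M"
  shows "zero_sum_array v n m M"
proof -
  obtain f where f: "(\<Sum>i<m. \<Sum>j<n. {#\<bar>f i j\<bar>#}) = image_mset abs M"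
    "\<forall>i<m. v dvd (\<Sum>j<n. f i j)" "\<forall>j<n. v dvd (\<Sum>i<m. f i j)"
    using assms unfolding zero_sum_array_def by blast
  have "(\<Sum>j<n. \<Sum>i<m. {#\<bar>f i j\<bar>#}) = image_mset abs M"
    using f(1) by (subst sum.swap)
  with f(2,3) show ?thesis
    unfolding zero_sum_array_def by (intro exI[of _ "\<lambda>j i. f i j"]) simp
qed

text \<open>Almost every value is needed twice. With these rules a covering identity is proved for a
  single copy of the values and then doubled.\<close>

lemma double_add2: "a + b = c \<Longrightarrow> a + a + (b + b) = c + c" for a b c :: "'a :: ab_semigroup_add"
  by (auto simp: ac_simps)

lemma double_add3: "a + b + c = d \<Longrightarrow> a + a + (b + b) + (c + c) = d + d"
  for a b c d :: "'a :: ab_semigroup_add"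
  by (auto simp: ac_simps)

lemma double_add4: "a + b + c + d = e \<Longrightarrow> a + a + (b + b) + (c + c) + (d + d) = e + e"
  for a b c d e :: "'a :: ab_semigroup_add"
  by (auto simp: ac_simps)

lemma sum_lessThan_add:
  fixes g :: "nat \<Rightarrow> 'a :: comm_monoid_add"
  shows "(\<Sum>i<a + b. g i) = (\<Sum>i<a. g i) + (\<Sum>i<b. g (a + i))"
  by (induction b) (simp_all add: add.assoc)

lemma zero_sum_array_stack:
  assumes "zero_sum_array v m n M" "zero_sum_array v m' n M'"
  shows "zero_sum_array v (m + m') n (M + M')"
proof -
  obtain f where f: "(\<Sum>i<m. \<Sum>j<n. {#\<bar>f i j\<bar>#}) = image_mset abs M"
    "\<forall>i<m. v dvd (\<Sum>j<n. f i j)" "\<forall>j<n. v dvd (\<Sum>i<m. f i j)"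
    using assms(1) unfolding zero_sum_array_def by blast
  obtain g where g: "(\<Sum>i<m'. \<Sum>j<n. {#\<bar>g i j\<bar>#}) = image_mset abs M'"
    "\<forall>i<m'. v dvd (\<Sum>j<n. g i j)" "\<forall>j<n. v dvd (\<Sum>i<m'. g i j)"
    using assms(2) unfolding zero_sum_array_def by blast
  define h where "h = (\<lambda>i. if i < m then f i else g (i - m))"
  have "v dvd (\<Sum>j<n. h i j)" if "i < m + m'" for i
    using that f(2) g(2) by (cases "i < m") (auto simp: h_def)
  then show ?thesis
    using f(1,3) g(1,3) unfolding zero_sum_array_def
    by (intro exI[of _ h]) (simp add: sum_lessThan_add h_def)
qed

lemma zero_sum_array_append:
  "zero_sum_array v m n M \<Longrightarrow> zero_sum_array v m n' M' \<Longrightarrow> zero_sum_array v m (n + n') (M + M')"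
  by (blast intro: zero_sum_array_transpose zero_sum_array_stack)

lemma zero_sum_array_empty: "zero_sum_array v m 0 {#}" "zero_sum_array v 0 n {#}"
  unfolding zero_sum_array_def by auto

lemma zero_sum_array_list:
  fixes xss :: "int list list"
  assumes "length xss = m" "\<forall>xs\<in>set xss. length xs = n \<and> v dvd sum_list xs"
    "\<forall>j<n. v dvd (\<Sum>xs\<leftarrow>xss. xs ! j)"
    "image_mset abs (mset (concat xss)) = image_mset abs M"
  shows "zero_sum_array v m n M"
  unfolding zero_sum_array_def
proof (intro exI[of _ "\<lambda>i j. xss ! i ! j"] conjI allI impI)
  have row: "(\<Sum>j<n. h (xs ! j)) = (\<Sum>x\<leftarrow>xs. h x)" if "length xs = n"
    for h :: "int \<Rightarrow> 'b :: comm_monoid_add" and xs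
    using that by (auto simp: sum_list_sum_nth atLeast0LessThan)
  have rows: "(\<Sum>i<m. h (xss ! i)) = (\<Sum>xs\<leftarrow>xss. h xs)"
    for h :: "int list \<Rightarrow> 'b :: comm_monoid_add"
    using assms(1) by (auto simp: sum_list_sum_nth atLeast0LessThan)
  have conc: "(\<Sum>xs\<leftarrow>yss. \<Sum>x\<leftarrow>xs. {#\<bar>x\<bar>#}) = image_mset abs (mset (concat yss))"
    for yss :: "int list list"
  proof (induction yss)
    case (Cons ys yss)
    have "(\<Sum>x\<leftarrow>ys. {#\<bar>x\<bar>#}) = image_mset abs (mset ys)" by (induction ys) auto
    with Cons show ?case by simp
  qed simp
  have "(\<Sum>i<m. \<Sum>j<n. {#\<bar>xss ! i ! j\<bar>#}) = (\<Sum>i<m. \<Sum>x\<leftarrow>xss ! i. {#\<bar>x\<bar>#})"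
    using assms(1,2) row[of _ "\<lambda>x. {#\<bar>x\<bar>#}"] by (intro sum.cong) auto
  then show "(\<Sum>i<m. \<Sum>j<n. {#\<bar>xss ! i ! j\<bar>#}) = image_mset abs M"
    using rows[of "\<lambda>xs. \<Sum>x\<leftarrow>xs. {#\<bar>x\<bar>#}"] conc assms(4) by metis
  show "v dvd (\<Sum>j<n. xss ! i ! j)" if "i < m" for i
    using that assms(1,2) row[of "xss ! i" "\<lambda>x. x"] by auto
  show "v dvd (\<Sum>i<m. xss ! i ! j)" if "j < n" for j
    using that assms(3) rows[of "\<lambda>xs. xs ! j"] by auto
qed

text \<open>As an introduction rule it turns the divisibility goals of an explicit symbolic array
  into linear equations.\<close>

lemma dvd_if_eq_0_or_self: "x = 0 \<or> x = v \<Longrightarrow> v dvd x" for x v :: int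
  by auto

section \<open>Basic blocks and consecutive pairs\<close>

lemma zero_sum_array_triple:
  assumes "c = a + b"
  shows "zero_sum_array v 3 2 ({#a, b, c#} + {#a, b, c#})"
  by (rule zero_sum_array_list[of "[[a, -a], [b, -b], [-c, c]]"])
     (use assms in \<open>auto simp: less_Suc_eq numeral_2_eq_2\<close>)

lemma zero_sum_array_tile:
  assumes "a + d = b + c"
  shows "zero_sum_array v 2 4 ({#a, b, c, d#} + {#a, b, c, d#})"
  by (rule zero_sum_array_list[of "[[a, -b, -c, d], [-a, b, c, -d]]"])
     (use assms in \<open>auto simp: less_Suc_eq eval_nat_numeral intro!: dvd_if_eq_0_or_self\<close>)

text \<open>\<open>X\<close> lists the lower members of the pairs. Any two pairs form a tile,
  wherever they lie, so a region filled by tiles only constrains the size of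
  \<open>X\<close>.\<close>

definition consecutive_pairs :: "int multiset \<Rightarrow> int multiset" where
  "consecutive_pairs X = (\<Sum>x\<in>#X. {#x, x + 1#})"

lemma consecutive_pairs_add:
  "consecutive_pairs (X + Y) = consecutive_pairs X + consecutive_pairs Y"
  by (simp add: consecutive_pairs_def)

lemma multiset_split_size: "size (X :: 'a multiset) = k + l \<Longrightarrow> \<exists>Y Z. X = Y + Z \<and> size Y = k \<and> size Z = l"
proof (induction k arbitrary: X)
  case (Suc k)
  then obtain x X' where X: "X = add_mset x X'" by (metis add_Suc size_eq_Suc_imp_eq_union)
  with Suc.prems have "size X' = k + l" by simp
  from Suc.IH[OF this] obtain Y Z where "X' = Y + Z" "size Y = k" "size Z = l" by blast
  with X show ?case by (intro exI[of _ "add_mset x Y"] exI[of _ Z]) simp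
qed auto

lemma zero_sum_array_2_pairs:
  "size X = 2 * b \<Longrightarrow> zero_sum_array v 2 (4 * b) (consecutive_pairs X + consecutive_pairs X)"
proof (induction b arbitrary: X)
  case 0
  then show ?case by (simp add: consecutive_pairs_def zero_sum_array_empty)
next
  case (Suc b)
  then have "size X = Suc (Suc (2 * b))" by simp
  then obtain x y X' where X: "X = add_mset x (add_mset y X')" and "size X' = 2 * b"
    by (metis size_Suc_Diff1 size_eq_Suc_imp_eq_union size_add_mset add_left_cancel plus_1_eq_Suc)
  \<comment> \<open>The tile condition here is \<open>x + (y + 1) = (x + 1) + y\<close>, which holds
    for every choice of the two pairs.\<close>
  from zero_sum_array_append[OF zero_sum_array_tile[of x "y + 1" "x + 1" y] Suc.IH[OF this(2)]]
  show ?case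
    by (simp add: X consecutive_pairs_def ac_simps add_mset_commute)
qed

lemma zero_sum_array_pairs:
  "size X = 2 * a * b \<Longrightarrow> zero_sum_array v (2 * a) (4 * b) (consecutive_pairs X + consecutive_pairs X)"
proof (induction a arbitrary: X)
  case 0
  then show ?case by (simp add: consecutive_pairs_def zero_sum_array_empty)
next
  case (Suc a)
  then have "size X = 2 * b + 2 * a * b" by (simp add: algebra_simps)
  then obtain Y Z where X: "X = Y + Z" "size Y = 2 * b" "size Z = 2 * a * b"
    using multiset_split_size by blast
  have "zero_sum_array v (2 + 2 * a) (4 * b)
     (consecutive_pairs Y + consecutive_pairs Y + (consecutive_pairs Z + consecutive_pairs Z))"
    using X zero_sum_array_2_pairs Suc.IH by (intro zero_sum_array_stack) auto
  then show ?case
    by (simp add: X consecutive_pairs_add ac_simps)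
qed

section \<open>Integer intervals as multisets\<close>

definition ivl :: "int \<Rightarrow> int \<Rightarrow> int multiset" where
  "ivl a b = mset_set {a..<b}"

lemma ivl_join: "a \<le> b \<Longrightarrow> b \<le> c \<Longrightarrow> ivl a b + ivl b c = ivl a c"
  unfolding ivl_def
  by (subst mset_set_Union[symmetric]) (auto simp: ivl_disj_un)

lemma ivl_empty [simp]: "b \<le> a \<Longrightarrow> ivl a b = {#}"
  by (simp add: ivl_def)

lemma ivl_singleton: "ivl a (a + 1) = {#a#}"
proof -
  have "{a..<a + 1} = {a}" by auto
  then show ?thesis by (simp add: ivl_def)
qed

lemma ivl_left: "a < b \<Longrightarrow> ivl a b = add_mset a (ivl (a + 1) b)"
  using ivl_join[of a "a + 1" b] by (simp add: ivl_singleton)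

lemma ivl_right: "a \<le> b \<Longrightarrow> ivl a (b + 1) = add_mset b (ivl a b)"
  using ivl_join[of a b "b + 1"] by (simp add: ivl_singleton)

lemma ivl_consecutive_pairs:
  "\<exists>X. size X = q \<and> consecutive_pairs X = ivl p (p + 2 * int q)"
proof (induction q arbitrary: p)
  case 0
  show ?case by (auto simp: consecutive_pairs_def)
next
  case (Suc q)
  from Suc.IH[of "p + 2"] obtain X
    where "size X = q" "consecutive_pairs X = ivl (p + 2) (p + 2 + 2 * int q)" by blast
  moreover have "ivl p (p + 2 * int (Suc q)) = add_mset p (add_mset (p + 1) (ivl (p + 2) (p + 2 + 2 * int q)))"
    using ivl_left[of p "p + 2 * int (Suc q)"] ivl_left[of "p + 1" "p + 2 * int (Suc q)"]
    by (simp add: algebra_simps)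
  ultimately show ?case
    by (intro exI[of _ "add_mset p X"]) (simp add: consecutive_pairs_def)
qed

text \<open>The index range may start anywhere, so that one family of blocks can be cut into
  consecutive ranges placed in different parts of an array.\<close>

lemma zero_sum_array_sum:
  assumes "\<And>i. i \<in> {a..<a + k} \<Longrightarrow> zero_sum_array v m n (F i + F i)"
  shows "zero_sum_array v m (k * n) (sum F {a..<a + k} + sum F {a..<a + k})"
  using assms
proof (induction k)
  case 0
  show ?case by (simp add: zero_sum_array_empty)
next
  case (Suc k)
  have "zero_sum_array v m (k * n + n)
      (sum F {a..<a + k} + sum F {a..<a + k} + (F (a + k) + F (a + k)))"
    using Suc by (intro zero_sum_array_append) auto
  then show ?case by (simp add: ac_simps)
qed

section \<open>Arrays with both sides even\<close>

lemma zero_sum_array_even_times_4: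
  assumes "even m" "4 dvd n" "2 * K = 2 * N + int (m * n)"
  shows "zero_sum_array v m n (ivl (N + 1) (K + 1) + ivl (N + 1) (K + 1))"
proof -
  obtain a b where ab: "m = 2 * a" "n = 4 * b"
    using assms by (auto elim!: dvdE)
  obtain X where X: "size X = 2 * a * b" "consecutive_pairs X = ivl (N + 1) (N + 1 + 2 * int (2 * a * b))"
    using ivl_consecutive_pairs by blast
  have "N + 1 + 2 * int (2 * a * b) = K + 1"
    using assms(3) by (simp add: ab)
  with X(2) have "consecutive_pairs X = ivl (N + 1) (K + 1)"
    by metis
  then show ?thesis
    using zero_sum_array_pairs[OF X(1), of v] unfolding ab by simp
qed

text \<open>
  The top two values almost add up to the modulus, so a \<open>2 \<times> 6\<close> block can repair the parity
  obstruction that both side lengths are \<open>2\<close> modulo \<open>4\<close>.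
\<close>

lemma zero_sum_array_2_6:
  assumes "a + b + d + f = c + e + v"
  shows "zero_sum_array v 2 6 ({#a, b, c, d, e, f#} + {#a, b, c, d, e, f#})"
proof -
  have "a + b - c + d - e + f = v"
    using assms by simp
  then have "v dvd sum_list [a, b, -c, d, -e, f]" "v dvd sum_list [-a, -b, c, -d, e, -f]"
    by (auto intro: dvdI[of _ _ 1] dvdI[of _ _ "-1"])
  then show ?thesis
    by (intro zero_sum_array_list[of "[[a, b, -c, d, -e, f], [-a, -b, c, -d, e, -f]]"])
       (auto simp: less_Suc_eq eval_nat_numeral)
qed

lemma zero_sum_array_2_mod_4:
  assumes "m = 4 * a + 2" "n = 4 * b + 6" "v = 2 * K + 1" "2 * K = 2 * N + int (m * n)"
  shows "zero_sum_array v m n (ivl (N + 1) (K + 1) + ivl (N + 1) (K + 1))"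
proof -
  \<comment> \<open>After the six values of the core, \<open>q\<close> pairs remain. The summands
    count those for the \<open>4 * a\<close> further rows and for the \<open>4 * b\<close> columns
    beside the core.\<close>
  define q where "q = 2 * (2 * b + 3) * a + 2 * 1 * b"
  have K: "K = N + 6 + 2 * int q"
    using assms by (simp add: q_def algebra_simps)
  obtain X where X: "size X = q" "consecutive_pairs X = ivl (N + 5) (N + 5 + 2 * int q)"
    using ivl_consecutive_pairs by blast
  then obtain Y Z where YZ: "X = Y + Z" "size Y = 2 * (2 * b + 3) * a" "size Z = 2 * 1 * b"
    unfolding q_def using multiset_split_size by blast
  \<comment> \<open>\<open>K + (K - 1) = v - 2\<close>, and the four smallest values, with
    alternating signs, supply the missing 2.\<close>
  let ?C = "{#K, K - 1, N + 1, N + 2, N + 3, N + 4#}"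
  let ?Y = "consecutive_pairs Y" and ?Z = "consecutive_pairs Z"
  have "zero_sum_array v 2 6 (?C + ?C)"
    by (rule zero_sum_array_2_6) (use assms(3) in simp)
  then have "zero_sum_array v 2 (6 + 4 * b) (?C + ?C + (?Z + ?Z))"
    using zero_sum_array_pairs[OF YZ(3)] by (intro zero_sum_array_append) auto
  moreover have "zero_sum_array v (4 * a) (6 + 4 * b) (?Y + ?Y)"
    using zero_sum_array_transpose[OF zero_sum_array_pairs[OF YZ(2)]] by (simp add: algebra_simps)
  ultimately have "zero_sum_array v (2 + 4 * a) (6 + 4 * b) (?C + ?C + (?Z + ?Z) + (?Y + ?Y))"
    by (rule zero_sum_array_stack)
  moreover have "?C + ?Z + ?Y = ivl (N + 1) (K + 1)"
  proof -
    have "?C + ?Z + ?Y = {#N + 1, N + 2, N + 3, N + 4#} + consecutive_pairs X + {#K - 1, K#}"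
      by (simp add: YZ(1) consecutive_pairs_add ac_simps)
    also have "\<dots> = ivl (N + 1) (N + 5) + ivl (N + 5) (N + 5 + 2 * int q) + ivl (N + 5 + 2 * int q) (K + 1)"
      unfolding X(2) by (simp add: ivl_left K algebra_simps)
    also have "\<dots> = ivl (N + 1) (K + 1)"
      by (simp add: ivl_join K)
    finally show ?thesis .
  qed
  then have "?C + ?C + (?Z + ?Z) + (?Y + ?Y) = ivl (N + 1) (K + 1) + ivl (N + 1) (K + 1)"
    by (rule double_add3)
  ultimately show ?thesis
    using assms(1,2) by (simp add: add.commute)
qed

text \<open>If neither side is divisible by 4, both are 2 modulo 4 and one is at least 6. The offset
  \<open>N\<close> leaves the smallest values to other rows, while \<open>K\<close> remains half of
  \<open>v - 1\<close>, as the wrap-around core requires.\<close>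

lemma zero_sum_array_even_even:
  assumes "even m" "even n" "m > 0" "n > 0" "\<not> (m = 2 \<and> n = 2)" "v = 2 * K + 1" "2 * K = 2 * N + int (m * n)"
  shows "zero_sum_array v m n (ivl (N + 1) (K + 1) + ivl (N + 1) (K + 1))"
proof -
  have *: "(\<exists>a. k = 4 * a) \<or> k = 2 \<or> (\<exists>a. k = 4 * a + 6)" if "even k" for k :: nat
    using that by presburger
  have sym: "2 * K = 2 * N + int (n * m)"
    using assms(7) by (simp add: mult.commute)
  consider "4 dvd n" | "4 dvd m" | "\<exists>a. m = 4 * a + 2" "\<exists>b. n = 4 * b + 6"
    | "\<exists>a. m = 4 * a + 6" "\<exists>b. n = 4 * b + 2"
    using *[OF assms(1)] *[OF assms(2)] assms(5) by (fastforce intro: exI[of _ "Suc _"])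
  then show ?thesis
  proof cases
    case 1
    with assms(1,7) show ?thesis by (intro zero_sum_array_even_times_4)
  next
    case 2
    with assms(2) sym show ?thesis by (intro zero_sum_array_transpose[OF zero_sum_array_even_times_4])
  next
    case 3
    then show ?thesis using zero_sum_array_2_mod_4[OF _ _ assms(6,7)] by blast
  next
    case 4
    then show ?thesis
      using zero_sum_array_transpose[OF zero_sum_array_2_mod_4[OF _ _ assms(6) sym]] by blast
  qed
qed

section \<open>Arrays with three rows\<close>

text \<open>The odd family surrounds the gap between \<open>b - 1\<close> and \<open>b\<close>, the
  even one surrounds \<open>w\<close>; each step extends their intervals by one value at both ends.
  The sum starts at 2 because the triples for \<open>i = 1\<close> and the centre \<open>w\<close>
  are kept for a core.\<close>

lemma nested_blocks:
  "(\<Sum>i\<in>{2..<2 + k}. {#2 * int i - 1, b - int i, b + int i - 1, 2 * int i, w - int i, w + int i#})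
     + {#1, 2, b - 1, b, w - 1, w, w + 1#}
   = ivl 1 (2 * int k + 3) + ivl (b - int k - 1) (b + int k + 1) + ivl (w - int k - 1) (w + int k + 2)"
proof (induction k)
  case 0
  show ?case by (simp add: ivl_left)
next
  case (Suc k)
  have "ivl 1 (2 * int (Suc k) + 3) = ivl 1 (2 * int k + 3) + {#2 * int k + 3, 2 * int k + 4#}"
    using ivl_right[of 1 "2 * int k + 3"] ivl_right[of 1 "2 * int k + 4"] by (simp add: ac_simps)
  moreover have "ivl (b - int (Suc k) - 1) (b + int (Suc k) + 1)
      = ivl (b - int k - 1) (b + int k + 1) + {#b - int k - 2, b + int k + 1#}"
    using ivl_left[of "b - int k - 2" "b + int k + 2"] ivl_right[of "b - int k - 1" "b + int k + 1"]
    by (simp add: algebra_simps)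
  moreover have "ivl (w - int (Suc k) - 1) (w + int (Suc k) + 2)
      = ivl (w - int k - 1) (w + int k + 2) + {#w - int k - 2, w + int k + 2#}"
    using ivl_left[of "w - int k - 2" "w + int k + 3"] ivl_right[of "w - int k - 1" "w + int k + 2"]
    by (simp add: algebra_simps)
  ultimately show ?case
    using Suc by (simp add: algebra_simps)
qed

text \<open>The even family is used with index \<open>i - 1\<close>, so its triple
  \<open>2, w - 1, w + 1\<close> lies in the first block of the sum, and only one odd triple and
  \<open>w\<close> are left for the core.\<close>

lemma nested_blocks_shifted:
  "(\<Sum>i\<in>{2..<2 + k}. {#2 * int i - 1, b - int i, b + int i - 1, 2 * int i - 2, w - int i + 1, w + int i - 1#})
     + {#1, b - 1, b, w#}
   = ivl 1 (2 * int k + 2) + ivl (b - int k - 1) (b + int k + 1) + ivl (w - int k) (w + int k + 1)"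
proof (induction k)
  case 0
  show ?case by (simp add: ivl_left)
next
  case (Suc k)
  have "ivl 1 (2 * int (Suc k) + 2) = ivl 1 (2 * int k + 2) + {#2 * int k + 2, 2 * int k + 3#}"
    using ivl_right[of 1 "2 * int k + 2"] ivl_right[of 1 "2 * int k + 3"] by (simp add: ac_simps)
  moreover have "ivl (b - int (Suc k) - 1) (b + int (Suc k) + 1)
      = ivl (b - int k - 1) (b + int k + 1) + {#b - int k - 2, b + int k + 1#}"
    using ivl_left[of "b - int k - 2" "b + int k + 2"] ivl_right[of "b - int k - 1" "b + int k + 1"]
    by (simp add: algebra_simps)
  moreover have "ivl (w - int (Suc k)) (w + int (Suc k) + 1)
      = ivl (w - int k) (w + int k + 1) + {#w - int k - 1, w + int k + 1#}"
    using ivl_left[of "w - int k - 1" "w + int k + 2"] ivl_right[of "w - int k" "w + int k + 1"]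
    by (simp add: algebra_simps)
  ultimately show ?case
    using Suc by (simp add: algebra_simps)
qed

lemma zero_sum_array_two_triples:
  assumes "c = a + b" "c' = a' + b'"
  shows "zero_sum_array v 3 4 ({#a, b, c, a', b', c'#} + {#a, b, c, a', b', c'#})"
  using zero_sum_array_append[OF zero_sum_array_triple[OF assms(1)] zero_sum_array_triple[OF assms(2)]]
  by (simp add: ac_simps add_mset_commute)

text \<open>
  The next two cores absorb the values left over by the nested families; they were found by computer
  search, for even and for odd \<open>h\<close> in the \<open>3 \<times> 2h\<close> arrays below.
\<close>

lemma zero_sum_array_3_6:
  assumes "a2 = a1 + 1" "a3 = a1 + 2" "a4 = a1 + 3" "b2 = b1 + 1" "c = 2 * a1 + 3" "d = a1 + b1 + 1"
    and "2 * b1 = 3 * a1 + 5"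
  shows "zero_sum_array v 3 6 ({#1, a1, a2, a3, a4, b1, b2, c, d#} + {#1, a1, a2, a3, a4, b1, b2, c, d#})"
  by (rule zero_sum_array_list[of "[[1, b1, -c, a1, -c, b1], [a3, -b2, a4, -d, a2, a2],
        [-a4, 1, a1, b2, a3, -d]]"],
      simp, (use assms in \<open>auto intro!: dvd_if_eq_0_or_self\<close>)[1],
      (use assms in \<open>auto simp: less_Suc_eq eval_nat_numeral intro!: dvd_if_eq_0_or_self\<close>)[1],
      simp add: add_mset_commute)

lemma zero_sum_array_3_6':
  assumes "a2 = a1 + 1" "a3 = a1 + 2" "a4 = a1 + 3" "b1 = a1 + d" "b2 = b1 + 1" "c = 2 * a1 + 3"
  shows "zero_sum_array v 3 6 ({#1, a1, a2, a3, a4, b1, b2, c, d#} + {#1, a1, a2, a3, a4, b1, b2, c, d#})"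
  by (rule zero_sum_array_list[of "[[1, b1, a4, a1, -c, -b2], [a3, -b2, -c, d, a2, a2],
        [-a4, 1, a1, -b1, a3, d]]"],
      simp, (use assms in \<open>auto intro!: dvd_if_eq_0_or_self\<close>)[1],
      (use assms in \<open>auto simp: less_Suc_eq eval_nat_numeral intro!: dvd_if_eq_0_or_self\<close>)[1],
      simp add: add_mset_commute)

text \<open>All row and column sums vanish over the integers, hence \<open>v\<close> is arbitrary.
  This lets the strip be stacked with further rows, where the modulus depends on the total number of
  rows.\<close>

lemma zero_sum_array_3_even:
  assumes "h > 0"
  shows "zero_sum_array v 3 (2 * h) (ivl 1 (3 * int h + 1) + ivl 1 (3 * int h + 1))"
proof -
  have "h = 1 \<or> h = 2 \<or> (\<exists>k. h = 2 * k + 4) \<or> (\<exists>k. h = 2 * k + 3)"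
    using assms by presburger
  then consider "h = 1" | "h = 2" | k where "h = 2 * k + 4" | k where "h = 2 * k + 3"
    by blast
  then show ?thesis
  proof cases
    case 1
    then show ?thesis
      using zero_sum_array_triple[of 3 1 2] by (simp add: ivl_left)
  next
    case 2
    have "zero_sum_array v 3 4 ({#1, 2, 3, 4, 5, 6#} + {#1, 2, 3, 4, 5, 6#})"
      by (rule zero_sum_array_list[of "[[1, 5, -2, -4], [3, -6, -3, 6], [-4, 1, 5, -2]]"])
         (auto simp: less_Suc_eq eval_nat_numeral)
    with 2 show ?thesis by (simp add: ivl_left)
  next
    case (3 k)
    define s where "s = int k + 1"
    \<comment> \<open>The centres put the odd family on \<open>2 * s + 5, ..., 4 * s + 4\<close> and
      the even one on \<open>4 * s + 6, ..., 6 * s + 6\<close>, whose hole at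
      \<open>5 * s + 6\<close> goes to the core.\<close>
    define F where "F = (\<lambda>i. {#2 * int i - 1, 3 * s + 5 - int i, 3 * s + 5 + int i - 1,
      2 * int i, 5 * s + 6 - int i, 5 * s + 6 + int i#})"
    let ?C = "{#1, 2 * s + 1, 2 * s + 2, 2 * s + 3, 2 * s + 4, 3 * s + 4, 3 * s + 5, 4 * s + 5, 5 * s + 6#}"
    \<comment> \<open>The even triple for \<open>i = 1\<close>, which the core does not
      absorb.\<close>
    let ?T = "{#2, 5 * s + 5, 5 * s + 7#}"
    let ?S = "sum F {2..<2 + k}"
    have "zero_sum_array v 3 (k * 4) (?S + ?S)"
      unfolding F_def by (intro zero_sum_array_sum zero_sum_array_two_triples) auto
    moreover have "zero_sum_array v 3 6 (?C + ?C)"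
      by (rule zero_sum_array_3_6) auto
    moreover have "zero_sum_array v 3 2 (?T + ?T)"
      by (rule zero_sum_array_triple) auto
    ultimately have "zero_sum_array v 3 (k * 4 + 6 + 2) (?S + ?S + (?C + ?C) + (?T + ?T))"
      by (intro zero_sum_array_append)
    moreover have "?S + ?C + ?T = ivl 1 (3 * int h + 1)"
    proof -
      have "?S + ?C + ?T = ?S + {#1, 2, 3 * s + 5 - 1, 3 * s + 5, 5 * s + 6 - 1, 5 * s + 6, 5 * s + 6 + 1#}
          + ({#2 * s + 1, 2 * s + 2, 2 * s + 3, 2 * s + 4#} + {#4 * s + 5#})"
        by (simp add: algebra_simps add_mset_commute)
      also have "?S + {#1, 2, 3 * s + 5 - 1, 3 * s + 5, 5 * s + 6 - 1, 5 * s + 6, 5 * s + 6 + 1#}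
          = ivl 1 (2 * s + 1) + ivl (2 * s + 5) (4 * s + 5) + ivl (4 * s + 6) (6 * s + 7)"
        unfolding F_def nested_blocks by (simp add: s_def algebra_simps)
      also have "{#2 * s + 1, 2 * s + 2, 2 * s + 3, 2 * s + 4#} = ivl (2 * s + 1) (2 * s + 5)"
        by (simp add: ivl_left algebra_simps)
      also have "{#4 * s + 5#} = ivl (4 * s + 5) (4 * s + 6)"
        using ivl_singleton[of "4 * s + 5"] by (simp add: algebra_simps)
      also have "ivl 1 (2 * s + 1) + ivl (2 * s + 5) (4 * s + 5) + ivl (4 * s + 6) (6 * s + 7)
          + (ivl (2 * s + 1) (2 * s + 5) + ivl (4 * s + 5) (4 * s + 6))
          = ivl 1 (2 * s + 1) + ivl (2 * s + 1) (2 * s + 5) + ivl (2 * s + 5) (4 * s + 5)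
          + ivl (4 * s + 5) (4 * s + 6) + ivl (4 * s + 6) (6 * s + 7)"
        by (simp add: ac_simps)
      also have "\<dots> = ivl 1 (6 * s + 7)"
        by (simp add: ivl_join s_def)
      finally show ?thesis using 3 by (simp add: s_def algebra_simps)
    qed
    then have "?S + ?S + (?C + ?C) + (?T + ?T) = ivl 1 (3 * int h + 1) + ivl 1 (3 * int h + 1)"
      by (rule double_add3)
    moreover have "k * 4 + 6 + 2 = 2 * h"
      using 3 by simp
    ultimately show ?thesis by (simp only:)
  next
    case (4 k)
    define s where "s = int k"
    \<comment> \<open>The two families trade places: the even one now lies below
      \<open>4 * s + 7\<close>, the odd one above it.\<close>
    define F where "F = (\<lambda>i. {#2 * int i - 1, 5 * s + 9 - int i, 5 * s + 9 + int i - 1,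
      2 * int i - 2, 3 * s + 6 - int i + 1, 3 * s + 6 + int i - 1#})"
    let ?C = "{#1, 2 * s + 2, 2 * s + 3, 2 * s + 4, 2 * s + 5, 5 * s + 8, 5 * s + 9, 4 * s + 7, 3 * s + 6#}"
    let ?S = "sum F {2..<2 + k}"
    have "zero_sum_array v 3 (k * 4) (?S + ?S)"
      unfolding F_def by (intro zero_sum_array_sum zero_sum_array_two_triples) auto
    moreover have "zero_sum_array v 3 6 (?C + ?C)"
      by (rule zero_sum_array_3_6') auto
    ultimately have "zero_sum_array v 3 (k * 4 + 6) (?S + ?S + (?C + ?C))"
      by (intro zero_sum_array_append)
    moreover have "?S + ?C = ivl 1 (3 * int h + 1)"
    proof -
      have "?S + ?C = ?S + {#1, 5 * s + 9 - 1, 5 * s + 9, 3 * s + 6#}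
          + ({#2 * s + 2, 2 * s + 3, 2 * s + 4, 2 * s + 5#} + {#4 * s + 7#})"
        by (simp add: algebra_simps add_mset_commute)
      also have "?S + {#1, 5 * s + 9 - 1, 5 * s + 9, 3 * s + 6#}
          = ivl 1 (2 * s + 2) + ivl (4 * s + 8) (6 * s + 10) + ivl (2 * s + 6) (4 * s + 7)"
        unfolding F_def nested_blocks_shifted by (simp add: s_def algebra_simps)
      also have "{#2 * s + 2, 2 * s + 3, 2 * s + 4, 2 * s + 5#} = ivl (2 * s + 2) (2 * s + 6)"
        by (simp add: ivl_left algebra_simps)
      also have "{#4 * s + 7#} = ivl (4 * s + 7) (4 * s + 8)"
        using ivl_singleton[of "4 * s + 7"] by (simp add: algebra_simps)
      also have "ivl 1 (2 * s + 2) + ivl (4 * s + 8) (6 * s + 10) + ivl (2 * s + 6) (4 * s + 7)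
          + (ivl (2 * s + 2) (2 * s + 6) + ivl (4 * s + 7) (4 * s + 8))
          = ivl 1 (2 * s + 2) + ivl (2 * s + 2) (2 * s + 6) + ivl (2 * s + 6) (4 * s + 7)
          + ivl (4 * s + 7) (4 * s + 8) + ivl (4 * s + 8) (6 * s + 10)"
        by (simp add: ac_simps)
      also have "\<dots> = ivl 1 (6 * s + 10)"
        by (simp add: ivl_join s_def)
      finally show ?thesis using 4 by (simp add: s_def algebra_simps)
    qed
    then have "?S + ?S + (?C + ?C) = ivl 1 (3 * int h + 1) + ivl 1 (3 * int h + 1)"
      by (rule double_add2)
    moreover have "k * 4 + 6 = 2 * h"
      using 4 by simp
    ultimately show ?thesis by (simp only:)
  qed
qed

lemma zero_sum_array_even:
  assumes "m \<ge> 2" "n \<ge> 2" "even n" "\<not> (m = 2 \<and> n = 2)" "2 * K = int (m * n)" "v = 2 * K + 1"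
  shows "zero_sum_array v m n (ivl 1 (K + 1) + ivl 1 (K + 1))"
proof -
  obtain h where h: "n = 2 * h" using assms by (auto elim: evenE)
  have K: "K = int m * int h" using assms h by simp
  \<comment> \<open>For odd \<open>m\<close> a strip of three rows is split off. For a
    \<open>5 x 2\<close> array this would leave the excluded \<open>2 x 2\<close> case, so that size
    gets an explicit array with column sums 11 and -11.\<close>
  consider "even m" | "m = 5" "n = 2" | "odd m" "\<not> (m = 5 \<and> n = 2)" by blast
  then show ?thesis
  proof cases
    case 1
    then show ?thesis using zero_sum_array_even_even[of m n v K 0] assms by simp
  next
    case 2
    then have "v = 11" "K = 5" using assms by auto
    have "zero_sum_array 11 5 2 ({#1, 2, 3, 4, 5#} + {#1, 2, 3, 4, 5#})"
      by (rule zero_sum_array_list[of "[[1, -1], [-2, 2], [3, -3], [4, -4], [5, -5]]"])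
         (auto simp: less_Suc_eq eval_nat_numeral)
    with 2 \<open>v = 11\<close> \<open>K = 5\<close> show ?thesis by (simp add: ivl_left)
  next
    case 3
    have "m = 3 \<or> m \<ge> 5" using assms(1) 3 by presburger
    then show ?thesis
    proof
      assume "m = 3"
      with zero_sum_array_3_even[of h v] assms(2) h K show ?thesis by simp
    next
      assume "m \<ge> 5"
      let ?I = "ivl 1 (3 * int h + 1)" and ?J = "ivl (3 * int h + 1) (K + 1)"
      have "2 * K = 2 * (3 * int h) + int ((m - 3) * n)"
        using \<open>m \<ge> 5\<close> by (simp add: K h of_nat_diff algebra_simps)
      moreover have "even (m - 3)" "m - 3 > 0" "n > 0" "\<not> (m - 3 = 2 \<and> n = 2)"
        using assms 3 \<open>m \<ge> 5\<close> by auto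
      ultimately have "zero_sum_array v (m - 3) n (?J + ?J)"
        using assms by (intro zero_sum_array_even_even)
      then have "zero_sum_array v (3 + (m - 3)) n (?I + ?I + (?J + ?J))"
        using zero_sum_array_3_even[of h v] assms(2) h by (intro zero_sum_array_stack) auto
      moreover have "?I + ?J = ivl 1 (K + 1)"
        by (rule ivl_join) (use \<open>m \<ge> 5\<close> in \<open>auto simp: K intro!: mult_right_mono\<close>)
      then have "?I + ?I + (?J + ?J) = ivl 1 (K + 1) + ivl 1 (K + 1)"
        by (rule double_add2)
      moreover have "3 + (m - 3) = m"
        using \<open>m \<ge> 5\<close> by simp
      ultimately show ?thesis by (simp only:)
    qed
  qed
qed

section \<open>Arrays with an odd number of cells\<close>

text \<open>Apart from \<open>(u, w, w)\<close>, the rows use the first triple \<open>1, c - 1, c\<close> and \<open>2, w - 1, w + 1\<close> of each nested family.\<close>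

lemma zero_sum_array_5_3:
  assumes "u = 2 * w" "w1 = w - 1" "w2 = w + 1" "c1 = c - 1" "v = 4 * w"
  shows "zero_sum_array v 5 3
    ({#u#} + ({#1, 2, c1, c, w1, w, w2#} + {#1, 2, c1, c, w1, w, w2#}))"
  by (rule zero_sum_array_list[of "[[u, w, w], [1, c1, -c], [1, -c, c1], [w1, 2, -w2], [w1, -w2, 2]]"],
      simp, (use assms in \<open>auto intro!: dvd_if_eq_0_or_self\<close>)[1],
      (use assms in \<open>auto simp: less_Suc_eq eval_nat_numeral intro!: dvd_if_eq_0_or_self\<close>)[1],
      simp add: add_mset_commute)

text \<open>A \<open>5 x 3\<close> core is extended downwards by \<open>a\<close> transposed blocks
  and to the right by \<open>b\<close> blocks on three rows; tiles fill the remaining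
  \<open>4 * a + 2\<close> rows and \<open>4 * b\<close> columns. The value \<open>2 * w\<close>
  occurs once because it is its own negative modulo \<open>4 * w\<close>.\<close>

lemma zero_sum_array_odd:
  fixes a b :: nat
  assumes "w = 4 + 3 * int a + 5 * int b + 4 * int a * int b"
  shows "zero_sum_array (4 * w) (5 + 4 * a) (3 + 4 * b)
    ({#2 * w#} + (ivl 1 (2 * w) + ivl 1 (2 * w)))"
proof -
  let ?v = "4 * w"
  define s where "s = int (a + b)"
  define q where "q = b * (2 * a + 1)"
  \<comment> \<open>This centre makes the odd family end exactly at
    \<open>2 * w - 1\<close>.\<close>
  define c where "c = 2 * w - s - 1"
  \<comment> \<open>each of the two gaps left by the nested families has even length \<open>2 * q\<close>, so consecutive pairs fill it\<close>
  have w: "w = 3 * s + 4 + 2 * int q"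
    using assms by (simp add: s_def q_def algebra_simps)
  define F where "F = (\<lambda>i. {#2 * int i - 1, c - int i, c + int i - 1, 2 * int i, w - int i, w + int i#})"
  let ?C = "{#1, 2, c - 1, c, w - 1, w, w + 1#}"
  \<comment> \<open>Adjacent index ranges: together the two sums run through one nested family of
    \<open>a + b\<close> blocks.\<close>
  let ?S = "sum F {2..<2 + a}" and ?T = "sum F {2 + a..<2 + a + b}"
  obtain X where X: "size X = q" "consecutive_pairs X = ivl (2 * s + 3) (2 * s + 3 + 2 * int q)"
    using ivl_consecutive_pairs by blast
  obtain Y where Y: "size Y = q" "consecutive_pairs Y = ivl (w + s + 2) (w + s + 2 + 2 * int q)"
    using ivl_consecutive_pairs by blast
  let ?P = "consecutive_pairs (X + Y)"
  have "zero_sum_array ?v 5 3 ({#2 * w#} + (?C + ?C))"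
    by (rule zero_sum_array_5_3) auto
  moreover have "zero_sum_array ?v 3 (a * 4) (?S + ?S)"
    unfolding F_def by (intro zero_sum_array_sum zero_sum_array_two_triples) auto
  then have "zero_sum_array ?v (a * 4) 3 (?S + ?S)"
    by (rule zero_sum_array_transpose)
  ultimately have "zero_sum_array ?v (5 + a * 4) 3 ({#2 * w#} + (?C + ?C) + (?S + ?S))"
    by (rule zero_sum_array_stack)
  moreover have "zero_sum_array ?v (3 + 2 * (2 * a + 1)) (b * 4) (?T + ?T + (?P + ?P))"
  proof (rule zero_sum_array_stack)
    show "zero_sum_array ?v 3 (b * 4) (?T + ?T)"
      unfolding F_def by (intro zero_sum_array_sum zero_sum_array_two_triples) auto
    have "size (X + Y) = 2 * (2 * a + 1) * b"
      using X(1) Y(1) by (simp add: q_def)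
    then show "zero_sum_array ?v (2 * (2 * a + 1)) (b * 4) (?P + ?P)"
      unfolding mult.commute[of b 4] by (rule zero_sum_array_pairs)
  qed
  ultimately have *: "zero_sum_array ?v (5 + a * 4) (3 + b * 4)
      ({#2 * w#} + (?C + ?C) + (?S + ?S) + (?T + ?T + (?P + ?P)))"
    by (intro zero_sum_array_append) (simp_all add: algebra_simps)
  have "?S + ?T + ?C + ?P = ivl 1 (2 * w)"
  proof -
    have "?S + ?T = sum F {2..<2 + (a + b)}"
      unfolding add.assoc[symmetric] by (rule sum.atLeastLessThan_concat[OF le_add1 le_add1])
    then have "?S + ?T + ?C = ivl 1 (2 * s + 3) + ivl (2 * w - 2 * s - 2) (2 * w) + ivl (w - s - 1) (w + s + 2)"
      using nested_blocks[where k = "a + b" and b = c and w = w] unfolding F_def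
      by (simp add: s_def c_def algebra_simps)
    also have "\<dots> + ?P = ivl 1 (2 * s + 3) + ivl (2 * s + 3) (w - s - 1) + ivl (w - s - 1) (w + s + 2)
        + ivl (w + s + 2) (2 * w - 2 * s - 2) + ivl (2 * w - 2 * s - 2) (2 * w)"
    proof -
      have "2 * s + 3 + 2 * int q = w - s - 1" "w + s + 2 + 2 * int q = 2 * w - 2 * s - 2"
        using w by auto
      then show ?thesis
        unfolding consecutive_pairs_add X(2) Y(2) by (simp only:) (simp add: ac_simps)
    qed
    also have "\<dots> = ivl 1 (2 * w)"
      using w by (simp add: ivl_join s_def)
    finally show ?thesis .
  qed
  then have "?S + ?S + (?T + ?T) + (?C + ?C) + (?P + ?P) = ivl 1 (2 * w) + ivl 1 (2 * w)"
    by (rule double_add4)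
  then have "{#2 * w#} + (?C + ?C) + (?S + ?S) + (?T + ?T + (?P + ?P))
      = {#2 * w#} + (ivl 1 (2 * w) + ivl 1 (2 * w))"
    by (simp only: ac_simps)
  moreover have "5 + a * 4 = 5 + 4 * a" "3 + b * 4 = 3 + 4 * b"
    by simp_all
  ultimately show ?thesis
    using * by (simp only:)
qed

section \<open>Heffter arrays\<close>

lemma sum_mset_sum:
  fixes g :: "'a \<Rightarrow> 'b :: comm_monoid_add"
  shows "(\<Sum>x\<in>#(\<Sum>i\<in>S. h i). g x) = (\<Sum>i\<in>S. \<Sum>x\<in>#h i. g x)"
  by (induction S rule: infinite_finite_induct) auto

lemma sum_replicate_2: "(\<Sum>x\<in>{a..<b}. replicate_mset 2 x) = ivl a b + ivl a b"
proof -
  have "(\<Sum>x\<in>{a..<b}. replicate_mset 2 x) = (\<Sum>x\<in>{a..<b}. {#x#} + {#x#})"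
    by (simp add: numeral_2_eq_2)
  then show ?thesis
    unfolding ivl_def by (simp only: sum.distrib sum_multiset_singleton)
qed

definition plus_minus :: "int \<Rightarrow> int \<Rightarrow> int multiset" where
  "plus_minus v x = {#x mod v, (- x) mod v#}"

lemma plus_minus_abs: "plus_minus v \<bar>x\<bar> = plus_minus v x"
  by (simp add: plus_minus_def abs_if add_mset_commute)

lemma plus_minus_mod: "{#x mod v, (- (x mod v)) mod v#} = plus_minus v x"
  by (simp add: plus_minus_def mod_minus_eq)

text \<open>For \<open>t = 1\<close> the subgroup is trivial, and row counts equal to
  \<open>n\<close> force every cell to be filled. Representatives then become irrelevant, so
  \<open>f\<close> may take any integer values.\<close>

lemma heffter_full_iff:
  assumes "m > 0" "n > 0" "v = int (m * n) + 1"
  shows "(\<exists>A. heffter 2 1 m n n m A) \<longleftrightarrow>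
    (\<exists>f. (\<Sum>i<m. \<Sum>j<n. plus_minus v (f i j)) = ivl 1 v + ivl 1 v \<and>
      (\<forall>i<m. v dvd (\<Sum>j<n. f i j)) \<and> (\<forall>j<n. v dvd (\<Sum>i<m. f i j)))"
    (is "_ \<longleftrightarrow> (\<exists>f. ?P f)")
proof -
  have v: "int (2 * n * m div 2 + 1) = v"
    using assms(3) by (simp add: mult.commute)
  have "v > 0"
    using assms by simp
  have "x \<in> subgrpJ v (int 1) \<longleftrightarrow> x = 0" for x
    using \<open>v > 0\<close> by (auto simp: subgrpJ_def dest: zdvd_imp_le)
  then have "x \<in> {0..<v} - subgrpJ v (int 1) \<longleftrightarrow> x \<in> {1..<v}" for x
    unfolding Diff_iff atLeastLessThan_iff by arith
  then have "{0..<v} - subgrpJ v (int 1) = {1..<v}"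
    by (rule set_eqI)
  then have rhs: "(\<Sum>x\<in>{0..<v} - subgrpJ v (int 1). replicate_mset 2 x) = ivl 1 v + ivl 1 v"
    by (simp only: sum_replicate_2)
  have lhs: "(\<Sum>\<^sub># (image_mset (\<lambda>c. {# the (A (fst c) (snd c)), (- the (A (fst c) (snd c))) mod v #})
      (mset_set (filled_cells m n A)))) = (\<Sum>i<m. \<Sum>j<n. plus_minus v (f i j))"
    if "\<And>i j. i < m \<Longrightarrow> j < n \<Longrightarrow> A i j = Some (f i j mod v)" for A f
  proof -
    have "filled_cells m n A = {..<m} \<times> {..<n}"
      using that by (auto simp: filled_cells_def)
    then have "(\<Sum>\<^sub># (image_mset (\<lambda>c. {# the (A (fst c) (snd c)), (- the (A (fst c) (snd c))) mod v #})
        (mset_set (filled_cells m n A))))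
      = (\<Sum>c\<in>{..<m} \<times> {..<n}. {# the (A (fst c) (snd c)), (- the (A (fst c) (snd c))) mod v #})"
      by (simp only: sum_unfold_sum_mset)
    also have "\<dots> = (\<Sum>(i, j)\<in>{..<m} \<times> {..<n}. plus_minus v (f i j))"
      by (rule sum.cong) (auto simp: that plus_minus_mod)
    finally show ?thesis
      by (simp only: sum.cartesian_product)
  qed
  show ?thesis
  proof
    assume "\<exists>A. heffter 2 1 m n n m A"
    then obtain A where A: "heffter 2 1 m n n m A" ..
    have rows: "{j. j < n \<and> A i j \<noteq> None} = {..<n}" if "i < m" for i
      using A that by (intro card_subset_eq) (auto simp: heffter_def Let_def)
    then have filled: "A i j \<noteq> None" if "i < m" "j < n" for i j
      using that by blast
    then have cols: "{i. i < m \<and> A i j \<noteq> None} = {..<m}" if "j < n" for j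
      using that by blast
    have A_eq: "A i j = Some (the (A i j) mod v)" if "i < m" "j < n" for i j
      using A filled[OF that] unfolding heffter_def Let_def v by (auto simp: mod_pos_pos_trivial)
    have "?P (\<lambda>i j. the (A i j))"
      using A rows cols lhs[of A "\<lambda>i j. the (A i j)", OF A_eq] rhs
      unfolding heffter_def Let_def v by (simp add: dvd_eq_mod_eq_0)
    then show "\<exists>f. ?P f" by (intro exI[of ?P "\<lambda>i j. the (A i j)"])
  next
    assume "\<exists>f. ?P f"
    then obtain f where f: "?P f" ..
    define A where "A = (\<lambda>i j. if i < m \<and> j < n then Some (f i j mod v) else None)"
    have rows: "{j. j < n \<and> A i j \<noteq> None} = {..<n}" if "i < m" for i
      using that by (auto simp: A_def)
    have cols: "{i. i < m \<and> A i j \<noteq> None} = {..<m}" if "j < n" for j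
      using that by (auto simp: A_def)
    have "heffter 2 1 m n n m A"
      unfolding heffter_def Let_def v
    proof (intro conjI allI impI)
      show "A i j = None" if "m \<le> i \<or> n \<le> j" for i j
        using that by (auto simp: A_def)
      show "0 \<le> x" "x < v" if "A i j = Some x" for i j x
        using that \<open>v > 0\<close> by (auto simp: A_def split: if_splits)
      show "card {j. j < n \<and> A i j \<noteq> None} = n" if "i < m" for i
        by (simp only: rows[OF that] card_lessThan)
      show "card {i. i < m \<and> A i j \<noteq> None} = m" if "j < n" for j
        by (simp only: cols[OF that] card_lessThan)
      show "(\<Sum>j\<in>{j. j < n \<and> A i j \<noteq> None}. the (A i j)) mod v = 0" if "i < m" for i
        unfolding rows[OF that] using f that by (simp add: A_def mod_sum_eq dvd_eq_mod_eq_0)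
      show "(\<Sum>i\<in>{i. i < m \<and> A i j \<noteq> None}. the (A i j)) mod v = 0" if "j < n" for j
        unfolding cols[OF that] using f that by (simp add: A_def mod_sum_eq dvd_eq_mod_eq_0)
      have "A i j = Some (f i j mod v)" if "i < m" "j < n" for i j
        using that by (simp add: A_def)
      then show "(\<Sum>\<^sub># (image_mset (\<lambda>c. {# the (A (fst c) (snd c)), (- the (A (fst c) (snd c))) mod v #})
          (mset_set (filled_cells m n A)))) = (\<Sum>x\<in>{0..<v} - subgrpJ v (int 1). replicate_mset 2 x)"
        using f unfolding rhs by (subst lhs) blast+
    qed (use assms in simp_all)
    then show "\<exists>A. heffter 2 1 m n n m A" by blast
  qed
qed

lemma heffter_of_zero_sum_array:
  assumes "m > 0" "n > 0" "v = int (m * n) + 1" "zero_sum_array v m n M"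
    "(\<Sum>x\<in>#M. plus_minus v x) = ivl 1 v + ivl 1 v"
  shows "\<exists>A. heffter 2 1 m n n m A"
proof -
  obtain f where f: "(\<Sum>i<m. \<Sum>j<n. {#\<bar>f i j\<bar>#}) = image_mset abs M"
    "\<forall>i<m. v dvd (\<Sum>j<n. f i j)" "\<forall>j<n. v dvd (\<Sum>i<m. f i j)"
    using assms(4) unfolding zero_sum_array_def by blast
  have "(\<Sum>i<m. \<Sum>j<n. plus_minus v (f i j)) = (\<Sum>x\<in>#(\<Sum>i<m. \<Sum>j<n. {#\<bar>f i j\<bar>#}). plus_minus v x)"
    by (simp add: sum_mset_sum plus_minus_abs)
  also have "\<dots> = (\<Sum>x\<in>#M. plus_minus v x)"
    unfolding f(1) by (simp add: plus_minus_abs image_mset.compositionality comp_def)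
  finally show ?thesis
    using f(2,3) assms(5) unfolding heffter_full_iff[OF assms(1-3)] by auto
qed

text \<open>Negation modulo \<open>v\<close> is the reflection of \<open>x\<close> to
  \<open>v - x\<close> on residues strictly between 0 and \<open>v\<close>.\<close>

lemma plus_minus_ivl:
  assumes "1 \<le> a" "a \<le> b" "b \<le> v"
  shows "(\<Sum>x\<in>#ivl a b. plus_minus v x) = ivl a b + ivl (v - b + 1) (v - a + 1)"
  using assms(2,3)
proof (induction b rule: int_ge_induct)
  case base
  show ?case by simp
next
  case (step b)
  have "(- b) mod v = (v - b) mod v"
    by simp
  also have "\<dots> = v - b"
    using step assms by (intro mod_pos_pos_trivial) auto
  finally have "plus_minus v b = {#b, v - b#}"
    using step assms by (simp add: plus_minus_def mod_pos_pos_trivial)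
  moreover have "ivl (v - b) (v - a + 1) = add_mset (v - b) (ivl (v - b + 1) (v - a + 1))"
    using step by (intro ivl_left) auto
  ultimately show ?case
    using step by (simp add: ivl_right)
qed

section \<open>Nonexistence\<close>

lemma sum_mod_2: "(\<Sum>x\<in>#ivl 1 (2 * int k + 2). x mod 2) = int k + 1"
proof (induction k)
  case 0
  show ?case by (simp add: ivl_left)
next
  case (Suc k)
  have "ivl 1 (2 * int (Suc k) + 2) = add_mset (2 * int k + 3) (add_mset (2 * int k + 2) (ivl 1 (2 * int k + 2)))"
    using ivl_right[of 1 "2 * int k + 2"] ivl_right[of 1 "2 * int k + 3"] by (simp add: ac_simps)
  with Suc show ?case by simp
qed

lemma no_heffter_1_mod_4:
  assumes "m * n mod 4 = 1"
  shows "\<not> (\<exists>A. heffter 2 1 m n n m A)"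
proof
  assume *: "\<exists>A. heffter 2 1 m n n m A"
  define v where "v = int (m * n) + 1"
  have mn: "m > 0" "n > 0"
    using assms by (auto intro: Nat.gr0I)
  obtain f where f: "(\<Sum>i<m. \<Sum>j<n. plus_minus v (f i j)) = ivl 1 v + ivl 1 v"
    "\<forall>i<m. v dvd (\<Sum>j<n. f i j)"
    using * unfolding heffter_full_iff[OF mn v_def] by blast
  obtain k where k: "m * n = 4 * k + 1"
    using assms by (metis mult.commute div_mult_mod_eq)
  then have v: "v = 2 * int (2 * k) + 2"
    by (simp add: v_def)
  have parity: "(x mod v) mod 2 = x mod 2" for x
    using v by (intro mod_mod_cancel) auto
  \<comment> \<open>As \<open>v\<close> is even, reduction modulo \<open>v\<close> and negation both
    preserve parity; summing \<open>x mod 2\<close> therefore counts each odd entry twice.\<close>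
  have "(\<Sum>x\<in>#plus_minus v x. x mod 2) = 2 * (x mod 2)" for x
    unfolding plus_minus_def by (simp add: parity) presburger
  then have "2 * (\<Sum>i<m. \<Sum>j<n. f i j mod 2) = (\<Sum>x\<in>#(\<Sum>i<m. \<Sum>j<n. plus_minus v (f i j)). x mod 2)"
    by (simp add: sum_mset_sum sum_distrib_left)
  also have "\<dots> = 2 * (2 * int k + 1)"
    unfolding f(1) using sum_mod_2[of "2 * k"] by (simp add: v)
  finally have "(\<Sum>i<m. \<Sum>j<n. f i j mod 2) = 2 * int k + 1"
    by simp
  then have "odd (\<Sum>i<m. \<Sum>j<n. f i j mod 2)"
    by simp
  moreover have "even (\<Sum>j<n. f i j mod 2)" if "i < m" for i
  proof -
    have "2 dvd v" by (simp add: v)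
    then have "even (\<Sum>j<n. f i j)" using f(2) that dvd_trans by blast
    then show ?thesis by (simp add: even_iff_mod_2_eq_zero mod_sum_eq)
  qed
  then have "even (\<Sum>i<m. \<Sum>j<n. f i j mod 2)"
    by (rule dvd_sum) simp
  ultimately show False by blast
qed

lemma no_heffter_2_2: "\<not> (\<exists>A. heffter 2 1 2 2 2 2 A)"
proof
  assume "\<exists>A. heffter 2 1 2 2 2 2 A"
  then obtain f :: "nat \<Rightarrow> nat \<Rightarrow> int" where
    f: "(\<Sum>i<2. \<Sum>j<2. plus_minus 5 (f i j)) = ivl 1 5 + ivl 1 5"
      "\<forall>i<2. 5 dvd (\<Sum>j<2. f i j)" "\<forall>j<2. 5 dvd (\<Sum>i<2. f i j)"
    using heffter_full_iff[of 2 2 5] by auto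
  have neg: "plus_minus 5 y = plus_minus 5 x" if "5 dvd x + y" for x y
  proof -
    have "y mod 5 = (- x) mod 5" "(- y) mod 5 = x mod 5"
      using that by presburger+
    then show ?thesis by (simp add: plus_minus_def add_mset_commute)
  qed
  have "5 dvd f 0 0 + f 0 1" "5 dvd f 1 0 + f 1 1" "5 dvd f 0 0 + f 1 0"
    using f(2)[rule_format, of 0] f(2)[rule_format, of 1] f(3)[rule_format, of 0]
    by (simp_all add: numeral_2_eq_2)
  then have "plus_minus 5 (f 0 1) = plus_minus 5 (f 0 0)" "plus_minus 5 (f 1 0) = plus_minus 5 (f 0 0)"
    "plus_minus 5 (f 1 1) = plus_minus 5 (f 0 0)"
    using neg by metis+
  \<comment> \<open>All four cells give the same pair of residues, so one residue occurs at least
    four times instead of twice.\<close>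
  then have "count (\<Sum>i<2. \<Sum>j<2. plus_minus 5 (f i j)) (f 0 0 mod 5) \<ge> 4"
    by (simp add: numeral_2_eq_2) (simp add: plus_minus_def)
  moreover have "count (ivl 1 5 + ivl 1 5) (f 0 0 mod 5) \<le> 2"
    by (simp add: ivl_def count_mset_set')
  ultimately show False
    using f(1) by simp
qed

section \<open>Existence according to the parity of the sides\<close>

lemma heffter_transpose:
  assumes "\<exists>A. heffter 2 1 m n n m A" "m > 0" "n > 0"
  shows "\<exists>A. heffter 2 1 n m m n A"
proof -
  define v where "v = int (m * n) + 1"
  then have v': "v = int (n * m) + 1" by (simp add: mult.commute)
  obtain f where f: "(\<Sum>i<m. \<Sum>j<n. plus_minus v (f i j)) = ivl 1 v + ivl 1 v"
    "\<forall>i<m. v dvd (\<Sum>j<n. f i j)" "\<forall>j<n. v dvd (\<Sum>i<m. f i j)"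
    using assms unfolding heffter_full_iff[OF assms(2,3) v_def] by blast
  have "(\<Sum>j<n. \<Sum>i<m. plus_minus v (f i j)) = ivl 1 v + ivl 1 v"
    using f(1) by (subst sum.swap)
  with f(2,3) show ?thesis
    unfolding heffter_full_iff[OF assms(3,2) v'] by (intro exI[of _ "\<lambda>j i. f i j"]) simp
qed

lemma heffter_even:
  assumes "m \<ge> 2" "n \<ge> 2" "even n" "\<not> (m = 2 \<and> n = 2)"
  shows "\<exists>A. heffter 2 1 m n n m A"
proof -
  obtain h where h: "n = 2 * h" using assms by (auto elim: evenE)
  define K v where "K = int (m * h)" and "v = int (m * n) + 1"
  have v: "v = 2 * K + 1" and "2 * K = int (m * n)"
    by (simp_all add: v_def K_def h)
  then have "zero_sum_array v m n (ivl 1 (K + 1) + ivl 1 (K + 1))"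
    using assms by (intro zero_sum_array_even)
  moreover have "(\<Sum>x\<in>#ivl 1 (K + 1) + ivl 1 (K + 1). plus_minus v x) = ivl 1 v + ivl 1 v"
  proof -
    have "K \<ge> 0" by (simp add: K_def)
    then have "(\<Sum>x\<in>#ivl 1 (K + 1). plus_minus v x) = ivl 1 (K + 1) + ivl (K + 1) v"
      using plus_minus_ivl[of 1 "K + 1" v] by (simp add: v)
    also have "\<dots> = ivl 1 v"
      using \<open>K \<ge> 0\<close> by (intro ivl_join) (auto simp: v)
    finally show ?thesis by simp
  qed
  ultimately show ?thesis
    using assms v_def by (intro heffter_of_zero_sum_array[of m n v]) auto
qed

lemma heffter_odd:
  assumes "m = 5 + 4 * a" "n = 3 + 4 * b"
  shows "\<exists>A. heffter 2 1 m n n m A"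
proof -
  define w where "w = 4 + 3 * int a + 5 * int b + 4 * int a * int b"
  have "w > 0" by (simp add: w_def add_pos_nonneg)
  have "zero_sum_array (4 * w) m n ({#2 * w#} + (ivl 1 (2 * w) + ivl 1 (2 * w)))"
    unfolding assms by (rule zero_sum_array_odd) (rule w_def)
  moreover have "(\<Sum>x\<in>#{#2 * w#} + (ivl 1 (2 * w) + ivl 1 (2 * w)). plus_minus (4 * w) x)
      = ivl 1 (4 * w) + ivl 1 (4 * w)"
  proof -
    \<comment> \<open>The single entry \<open>2 * w\<close> equals its negative and thus supplies
      both required copies of that residue.\<close>
    have "(- (2 * w)) mod (4 * w) = (4 * w - 2 * w) mod (4 * w)"
      by (metis add.commute mod_add_self1 uminus_add_conv_diff)
    then have "plus_minus (4 * w) (2 * w) = {#2 * w, 2 * w#}"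
      using \<open>w > 0\<close> by (simp add: plus_minus_def)
    moreover have "(\<Sum>x\<in>#ivl 1 (2 * w). plus_minus (4 * w) x) = ivl 1 (2 * w) + ivl (2 * w + 1) (4 * w)"
      using plus_minus_ivl[of 1 "2 * w" "4 * w"] \<open>w > 0\<close> by simp
    moreover have "ivl 1 (2 * w) + ivl (2 * w + 1) (4 * w) + {#2 * w#} = ivl 1 (4 * w)"
      using ivl_join[of 1 "2 * w" "4 * w"] ivl_left[of "2 * w" "4 * w"] \<open>w > 0\<close> by simp
    ultimately show ?thesis
      using double_add2[of "ivl 1 (2 * w) + ivl (2 * w + 1) (4 * w)" "{#2 * w#}"] by (simp add: ac_simps)
  qed
  moreover have "4 * w = int (m * n) + 1"
    by (simp add: assms w_def algebra_simps)
  ultimately show ?thesis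
    using assms by (intro heffter_of_zero_sum_array[of m n "4 * w"]) auto
qed

theorem theorem4:
  fixes m n :: nat
  assumes "m \<ge> 2" and "n \<ge> 2"
  shows "(\<exists>A. heffter 2 1 m n n m A) \<longleftrightarrow>
           (m * n mod 4 \<noteq> 1 \<and> \<not> (m = 2 \<and> n = 2))"
proof
  assume "\<exists>A. heffter 2 1 m n n m A"
  then show "m * n mod 4 \<noteq> 1 \<and> \<not> (m = 2 \<and> n = 2)"
    using no_heffter_1_mod_4 no_heffter_2_2 by blast
next
  assume *: "m * n mod 4 \<noteq> 1 \<and> \<not> (m = 2 \<and> n = 2)"
  consider "even n" | "even m" | "odd m" "odd n"
    by blast
  then show "\<exists>A. heffter 2 1 m n n m A"
  proof cases
    case 1
    then show ?thesis using heffter_even assms * by blast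
  next
    case 2
    then show ?thesis using heffter_even[of n m] heffter_transpose[of n m] assms * by auto
  next
    case 3
    have "m mod 4 \<noteq> n mod 4"
    proof
      assume eq: "m mod 4 = n mod 4"
      have "n mod 4 = 1 \<or> n mod 4 = 3" using 3 by presburger
      then have "(n mod 4) * (n mod 4) mod 4 = 1" by auto
      with eq * show False by (metis mod_mult_eq)
    qed
    \<comment> \<open>One side is 1 and the other 3 modulo 4; being at least 2, the former is at
      least 5.\<close>
    then have "(\<exists>a b. m = 5 + 4 * a \<and> n = 3 + 4 * b) \<or> (\<exists>a b. n = 5 + 4 * a \<and> m = 3 + 4 * b)"
      using 3 assms by presburger
    then show ?thesis
    proof
      assume "\<exists>a b. m = 5 + 4 * a \<and> n = 3 + 4 * b"
      then show ?thesis using heffter_odd by blast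
    next
      assume "\<exists>a b. n = 5 + 4 * a \<and> m = 3 + 4 * b"
      then have "\<exists>A. heffter 2 1 n m m n A" using heffter_odd by blast
      then show ?thesis using heffter_transpose assms by simp
    qed
  qed
qed

end
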